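(* Let $\Delta$ be a (finite) $(d-1)$-dimensional simplicial complex with $f$-vector $f^\Delta=(f^\Delta_{-1},\ldots,f^\Delta_{d-1})$ and let $1\leq l\leq d$. Then for all $0\leq i\leq d$, $$f_{i-1}^{\mathrm{sd}^l(\Delta)}=\sum_{j=0}^d f^\Delta_{j-1}\cdot R(j,i,l).$$
   Context: For a simplicial complex $\Delta$ of dimension $d-1$, $f_i^\Delta$ denotes the number of $i$-dimensional faces of $\Delta$ (with $f_{-1}^\Delta=1$ counting the empty face). The $l$-th partial barycentric subdivision $\mathrm{sd}^l(\Delta)$, $1\leq l\leq d$, is the subdivision of $\Delta$ in which exactly the faces of dimension $\geq l$ are barycentrically subdivided (coned over their barycenters). Combinatorially it is the following simplicial complex. Its vertices are the vertices of $\Delta$ together with one vertex (the barycenter) for each face $F\in\Delta$ with $\#F\geq l+1$. Its $(i-1)$-dimensional faces are indexed by strictly increasing chains $A_0\subset A_1\subset\cdots\subset A_r$ ($r\geq 0$) of faces of $\Delta$ such that $0\leq \#A_0\leq l$, $\#A_1\geq l+1$ (if $r\geq 1$), $\#A_0+r=i$ and $A_r\in\Delta$; the corresponding face has as vertices the elements of $A_0$ and the barycenters of $A_1,\ldots,A_r$. In particular $\mathrm{sd}^1(\Delta)$ is the usual barycentric subdivision and $\mathrm{sd}^d(\Delta)=\Delta$. The restricted Stirling number $R(j,i,l)$ is the number of ordered systems $|B_0|B_1|\cdots|B_r|$ ($r\geq 0$ arbitrary) of pairwise disjoint sets, where $B_1,\ldots,B_r\neq\emptyset$ and $B_0$ may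 be empty, such that (P1) $B_0\cup\cdots\cup B_r=[j]=\{1,\ldots,j\}$; (P2) $\#B_0\leq l$, and if $r\geq 1$ then $\#(B_0\cup B_1)\geq l+1$; (P3) $\#B_0+r=i$. *)

theory Defs
  imports Main
begin

text \<open>Abstract simplicial complexes. The empty face is always present, so
  the number of faces of dimension -1 is 1.\<close>

definition abstract_simplicial_complex :: "'a set set \<Rightarrow> bool" where
  "abstract_simplicial_complex \<Delta> \<longleftrightarrow>
     {} \<in> \<Delta> \<and> (\<forall>F\<in>\<Delta>. finite F) \<and> (\<forall>F\<in>\<Delta>. \<forall>G. G \<subseteq> F \<longrightarrow> G \<in> \<Delta>)"

definition face_dim :: "'a set \<Rightarrow> int" where
  "face_dim F = int (card F) - 1"

text \<open>Only meaningful for finite nonempty \<open>\<Delta>\<close>.\<close>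

definition complex_dim :: "'a set set \<Rightarrow> int" where
  "complex_dim \<Delta> = Max (face_dim ` \<Delta>)"

definition f_number :: "'a set set \<Rightarrow> int \<Rightarrow> nat" where
  "f_number \<Delta> i = card {F \<in> \<Delta>. face_dim F = i}"

text \<open>The chain \<open>A\<^sub>0 \<subset> A\<^sub>1 \<subset> \<dots> \<subset> A\<^sub>r\<close> is represented by the set \<open>A\<^sub>0\<close> and the list
  \<open>As = [A\<^sub>1, \<dots>, A\<^sub>r]\<close>.\<close>

definition sd_chain :: "nat \<Rightarrow> 'a set set \<Rightarrow> 'a set \<Rightarrow> 'a set list \<Rightarrow> bool" where
  "sd_chain l \<Delta> A0 As \<longleftrightarrow>
     set (A0 # As) \<subseteq> \<Delta> \<and> sorted_wrt (\<subset>) (A0 # As) \<and>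
     card A0 \<le> l \<and> (As \<noteq> [] \<longrightarrow> card (hd As) \<ge> l + 1)"

text \<open>The \<open>l\<close>-th partial barycentric subdivision: \<open>Inl v\<close> is an old vertex \<open>v\<close> and \<open>Inr F\<close> is
  the barycenter of the face \<open>F\<close>.\<close>

definition partial_sd :: "nat \<Rightarrow> 'a set set \<Rightarrow> ('a + 'a set) set set" where
  "partial_sd l \<Delta> = {Inl ` A0 \<union> Inr ` set As | A0 As. sd_chain l \<Delta> A0 As}"

text \<open>The restricted Stirling number \<open>R(j,i,l)\<close>. A system \<open>|B\<^sub>0|B\<^sub>1|\<dots>|B\<^sub>r|\<close> is the pair of the
  possibly empty set \<open>B\<^sub>0\<close> and the list \<open>Bs = [B\<^sub>1, \<dots>, B\<^sub>r]\<close> of nonempty sets.\<close>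

definition restricted_stirling :: "nat \<Rightarrow> nat \<Rightarrow> nat \<Rightarrow> nat" where
  "restricted_stirling j i l = card {(B0 :: nat set, Bs :: nat set list).
     sorted_wrt (\<lambda>X Y. X \<inter> Y = {}) (B0 # Bs) \<and> {} \<notin> set Bs \<and>
     \<Union> (set (B0 # Bs)) = {1..j} \<and>
     card B0 \<le> l \<and> (Bs \<noteq> [] \<longrightarrow> card (B0 \<union> hd Bs) \<ge> l + 1) \<and>
     card B0 + length Bs = i}"

end

theory Submission
  imports Defs
begin

text \<open>
  A chain \<open>A\<^sub>0 \<subset> A\<^sub>1 \<subset> \<dots> \<subset> A\<^sub>r\<close> with top element \<open>A\<^sub>r = F\<close> carries the same information as
  the ordered system of its increments \<open>|A\<^sub>0|A\<^sub>1 - A\<^sub>0|\<dots>|A\<^sub>r - A\<^sub>r\<^sub>-\<^sub>1|\<close>, which covers \<open>F\<close>; the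
  chain is recovered by taking partial unions. Strictness of the chain corresponds to the
  nonemptiness of the blocks after the first, and \<open>A\<^sub>1 = B\<^sub>0 \<union> B\<^sub>1\<close> makes the size
  conditions agree. Hence the chains with top \<open>F\<close> of total size \<open>i\<close> are counted by
  \<open>R(#F, i, l)\<close> (\<open>card_chains_to\<close>), because the number of systems covering \<open>F\<close> depends only on
  \<open>#F\<close>.

  A face of the subdivision determines its chain: the old vertices give \<open>A\<^sub>0\<close>, and a set of
  faces can be arranged into a strictly increasing list in at most one way. So the
  \<open>(i - 1)\<close>-dimensional faces of the subdivision are counted by the chains in \<open>\<Delta>\<close> of total
  size \<open>i\<close>. As \<open>\<Delta>\<close> is closed under subsets, a chain lies in \<open>\<Delta>\<close> as soon as its top does,
  and sorting the chains by their top \<open>F\<close>, and then the faces \<open>F\<close> by their cardinality \<open>j\<close>,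
  yields the formula.
\<close>

section \<open>Strict chains and their increments\<close>

fun partial_unions :: "'a set \<Rightarrow> 'a set list \<Rightarrow> 'a set list" where
  "partial_unions X [] = []"
| "partial_unions X (B # Bs) = (X \<union> B) # partial_unions (X \<union> B) Bs"

fun increments :: "'a set \<Rightarrow> 'a set list \<Rightarrow> 'a set list" where
  "increments X [] = []"
| "increments X (A # As) = (A - X) # increments A As"

lemma length_partial_unions [simp]: "length (partial_unions X Bs) = length Bs"
  by (induction Bs arbitrary: X) auto

lemma length_increments [simp]: "length (increments X As) = length As"
  by (induction As arbitrary: X) auto

lemma last_partial_unions: "last (X # partial_unions X Bs) = X \<union> \<Union> (set Bs)"
  by (induction Bs arbitrary: X) auto

lemma strict_chain_partial_unions:
  assumes "sorted_wrt (\<lambda>X Y. X \<inter> Y = {}) (X # Bs)" "{} \<notin> set Bs"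
  shows "sorted_wrt (\<subset>) (X # partial_unions X Bs)"
  using assms
proof (induction Bs arbitrary: X)
  case (Cons B Bs)
  have "sorted_wrt (\<subset>) ((X \<union> B) # partial_unions (X \<union> B) Bs)"
    using Cons.prems by (intro Cons.IH) auto
  moreover have "X \<subset> X \<union> B" using Cons.prems by auto
  ultimately show ?case by auto
qed auto

lemma increments_partial_unions:
  assumes "sorted_wrt (\<lambda>X Y. X \<inter> Y = {}) (X # Bs)"
  shows "increments X (partial_unions X Bs) = Bs"
  using assms
proof (induction Bs arbitrary: X)
  case (Cons B Bs)
  have "increments (X \<union> B) (partial_unions (X \<union> B) Bs) = Bs"
    using Cons.prems by (intro Cons.IH) auto
  then show ?case using Cons.prems by auto
qed auto

lemma partial_unions_increments:
  assumes "sorted_wrt (\<subset>) (X # As)"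
  shows "partial_unions X (increments X As) = As"
  using assms
proof (induction As arbitrary: X)
  case (Cons A As)
  then have "X \<union> (A - X) = A" by auto
  moreover have "partial_unions A (increments A As) = As"
    using Cons.prems by (intro Cons.IH) simp
  ultimately show ?case by simp
qed auto

lemma Union_increments:
  assumes "sorted_wrt (\<subset>) (X # As)"
  shows "X \<union> \<Union> (set (increments X As)) = last (X # As)"
  using last_partial_unions[of X "increments X As"] partial_unions_increments[OF assms] by simp

lemma increment_disjoint_start:
  assumes "sorted_wrt (\<subset>) (X # As)" "B \<in> set (increments X As)"
  shows "X \<inter> B = {}"
  using assms
proof (induction As arbitrary: X)
  case (Cons A As)
  have "X \<subset> A" using Cons.prems by auto
  consider "B = A - X" | "B \<in> set (increments A As)" using Cons.prems by auto
  then show ?case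
  proof cases
    case 2
    then have "A \<inter> B = {}" using Cons.prems by (intro Cons.IH) auto
    with \<open>X \<subset> A\<close> show ?thesis by auto
  qed auto
qed auto

lemma disjoint_increments:
  assumes "sorted_wrt (\<subset>) (X # As)"
  shows "sorted_wrt (\<lambda>X Y. X \<inter> Y = {}) (X # increments X As)"
  using assms
proof (induction As arbitrary: X)
  case (Cons A As)
  have "sorted_wrt (\<lambda>X Y. X \<inter> Y = {}) (A # increments A As)"
    using Cons.prems by (intro Cons.IH) simp
  then have "sorted_wrt (\<lambda>X Y. X \<inter> Y = {}) (increments X (A # As))" by auto
  with increment_disjoint_start[OF Cons.prems] show ?case by auto
qed auto

lemma empty_notin_increments:
  assumes "sorted_wrt (\<subset>) (X # As)"
  shows "{} \<notin> set (increments X As)"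
  using assms
proof (induction As arbitrary: X)
  case (Cons A As)
  have "{} \<notin> set (increments A As)"
    using Cons.prems by (intro Cons.IH) simp
  then show ?case using Cons.prems by auto
qed simp

text \<open>Cardinality is strictly monotone along a chain of finite sets, so the chain is its set of
  members sorted by cardinality.\<close>

lemma strict_chain_eqI:
  assumes "sorted_wrt (\<subset>) As" "sorted_wrt (\<subset>) Bs" "set As = set Bs"
    and fin: "\<forall>A\<in>set As. finite A"
  shows "As = Bs"
proof -
  have sorted: "sorted_wrt (<) (map card Cs)"
    if "sorted_wrt (\<subset>) Cs" "\<forall>A\<in>set Cs. finite A" for Cs :: "'a set list"
    unfolding sorted_wrt_map
    by (rule sorted_wrt_mono_rel[OF _ that(1)]) (use that(2) psubset_card_mono in blast)
  \<comment> \<open>Strictly increasing lists of numbers with the same members coincide.\<close>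
  have eq: "map card As = map card Bs"
    using assms sorted by (intro strict_sorted_equal) auto
  have "distinct (map card As)"
    using assms sorted strict_sorted_iff by blast
  then have "inj_on card (set As)" by (simp add: distinct_map)
  with eq assms(3) show ?thesis by (simp add: inj_on_map_eq_map)
qed

section \<open>Counting the chains below a given face\<close>

text \<open>Fixing the top \<open>F\<close> stands in for membership in a complex: all members of the chain are
  subsets of \<open>F\<close>, so they are faces of any complex that contains \<open>F\<close>.\<close>

definition chains_to :: "'a set \<Rightarrow> nat \<Rightarrow> nat \<Rightarrow> ('a set \<times> 'a set list) set" where
  "chains_to F i l = {(A0, As). sorted_wrt (\<subset>) (A0 # As) \<and> last (A0 # As) = F \<and>
     card A0 \<le> l \<and> (As \<noteq> [] \<longrightarrow> card (hd As) \<ge> l + 1) \<and> card A0 + length As = i}"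

text \<open>The systems counted by the restricted Stirling number, over an arbitrary ground set \<open>S\<close>
  in place of \<open>{1..j}\<close>, so that chains of faces can be compared with them without labelling
  the vertices.\<close>

definition block_systems :: "'a set \<Rightarrow> nat \<Rightarrow> nat \<Rightarrow> ('a set \<times> 'a set list) set" where
  "block_systems S i l = {(B0, Bs).
     sorted_wrt (\<lambda>X Y. X \<inter> Y = {}) (B0 # Bs) \<and> {} \<notin> set Bs \<and>
     \<Union> (set (B0 # Bs)) = S \<and>
     card B0 \<le> l \<and> (Bs \<noteq> [] \<longrightarrow> card (B0 \<union> hd Bs) \<ge> l + 1) \<and>
     card B0 + length Bs = i}"

lemma restricted_stirling_eq: "restricted_stirling j i l = card (block_systems {1..j} i l)"
  unfolding restricted_stirling_def block_systems_def ..

text \<open>Taking increments is a bijection with inverse taking partial unions; both keep the first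
  set and the number of sets, and the second set of the chain is the union of the first two
  blocks, so all size conditions carry over verbatim.\<close>

lemma card_chains_to_eq_block_systems: "card (chains_to F i l) = card (block_systems F i l)"
proof -
  let ?f = "\<lambda>(A0, As). (A0, increments A0 As)"
  let ?g = "\<lambda>(B0, Bs). (B0, partial_unions B0 Bs)"
  have f: "?f p \<in> block_systems F i l \<and> ?g (?f p) = p" if "p \<in> chains_to F i l" for p
  proof -
    obtain A0 As where p: "p = (A0, As)" by fastforce
    have sorted: "sorted_wrt (\<subset>) (A0 # As)"
      using that by (simp add: p chains_to_def)
    have first: "A0 \<union> hd (increments A0 As) = hd As" if "As \<noteq> []"
      using sorted that by (cases As) auto
    have "As \<noteq> [] \<longleftrightarrow> increments A0 As \<noteq> []" by (cases As) auto
    then show ?thesis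
      using that first disjoint_increments[OF sorted] empty_notin_increments[OF sorted]
        Union_increments[OF sorted] partial_unions_increments[OF sorted]
      unfolding p chains_to_def block_systems_def by simp
  qed
  have g: "?g p \<in> chains_to F i l \<and> ?f (?g p) = p" if "p \<in> block_systems F i l" for p
  proof -
    obtain B0 Bs where p: "p = (B0, Bs)" by fastforce
    have disj: "sorted_wrt (\<lambda>X Y. X \<inter> Y = {}) (B0 # Bs)" and ne: "{} \<notin> set Bs"
      using that by (simp_all add: p block_systems_def)
    have first: "hd (partial_unions B0 Bs) = B0 \<union> hd Bs" if "Bs \<noteq> []"
      using that by (cases Bs) auto
    have "Bs \<noteq> [] \<longleftrightarrow> partial_unions B0 Bs \<noteq> []" by (cases Bs) auto
    then show ?thesis
      using that first strict_chain_partial_unions[OF disj ne] last_partial_unions[of B0 Bs]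
        increments_partial_unions[OF disj]
      unfolding p chains_to_def block_systems_def by simp
  qed
  have "bij_betw ?f (chains_to F i l) (block_systems F i l)"
    by (rule bij_betw_byWitness[where f' = ?g]) (use f g in blast)+
  then show ?thesis by (rule bij_betw_same_card)
qed

text \<open>Injectivity of \<open>h\<close> on the ground set is what preserves both the disjointness of the
  blocks and their sizes.\<close>

lemma image_block_systems:
  assumes "(B0, Bs) \<in> block_systems S i l" "inj_on h S"
  shows "(h ` B0, map (image h) Bs) \<in> block_systems (h ` S) i l"
proof -
  have sub: "X \<subseteq> S" if "X \<in> set (B0 # Bs)" for X
    using assms(1) that by (auto simp: block_systems_def)
  have card: "card (h ` X) = card X" if "X \<subseteq> S" for X
    using assms(2) that by (meson card_image inj_on_subset)
  have "sorted_wrt (\<lambda>X Y. X \<inter> Y = {}) (map (image h) (B0 # Bs))"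
    unfolding sorted_wrt_map
  proof (rule sorted_wrt_mono_rel)
    show "sorted_wrt (\<lambda>X Y. X \<inter> Y = {}) (B0 # Bs)"
      using assms(1) by (simp add: block_systems_def)
    show "h ` X \<inter> h ` Y = {}"
      if "X \<in> set (B0 # Bs)" "Y \<in> set (B0 # Bs)" "X \<inter> Y = {}" for X Y
      using that sub inj_on_image_Int[OF assms(2), of X Y] by (metis image_empty)
  qed
  moreover have "card (h ` B0 \<union> hd (map (image h) Bs)) = card (B0 \<union> hd Bs)" if "Bs \<noteq> []"
  proof -
    have "B0 \<union> hd Bs \<subseteq> S" using that sub by (cases Bs) auto
    then show ?thesis using card that by (simp add: hd_map flip: image_Un)
  qed
  moreover have "\<Union> (set (h ` B0 # map (image h) Bs)) = h ` S"
    using assms(1) by (auto simp: block_systems_def)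
  moreover have "card (h ` B0) = card B0" using card sub by simp
  ultimately show ?thesis
    using assms(1) by (auto simp: block_systems_def)
qed

lemma image_block_systems_inverse:
  assumes "(B0, Bs) \<in> block_systems S i l" "\<And>x. x \<in> S \<Longrightarrow> g (h x) = x"
  shows "g ` h ` B0 = B0" "map (image g) (map (image h) Bs) = Bs"
proof -
  have inv: "g ` h ` X = X" if "X \<in> set (B0 # Bs)" for X
  proof -
    have "X \<subseteq> S" using assms(1) that by (auto simp: block_systems_def)
    then have "(\<lambda>x. g (h x)) ` X = (\<lambda>x. x) ` X"
      by (intro image_cong) (use assms(2) in blast)+
    then show ?thesis by (simp add: image_image)
  qed
  from inv show "g ` h ` B0 = B0" by simp
  from inv show "map (image g) (map (image h) Bs) = Bs" by (simp add: map_idI)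
qed

lemma card_block_systems_cong:
  assumes h: "bij_betw h S T"
  shows "card (block_systems S i l) = card (block_systems T i l)"
proof -
  define g where "g = inv_into S h"
  have g: "bij_betw g T S" unfolding g_def using h by (rule bij_betw_inv_into)
  have gh: "g (h x) = x" if "x \<in> S" for x
    unfolding g_def using h that by (rule bij_betw_inv_into_left)
  have hg: "h (g y) = y" if "y \<in> T" for y
    unfolding g_def using h that by (rule bij_betw_inv_into_right)
  have "bij_betw (map_prod (image h) (map (image h))) (block_systems S i l) (block_systems T i l)"
  proof (rule bij_betw_byWitness[where f' = "map_prod (image g) (map (image g))"])
    show "\<forall>p\<in>block_systems S i l.
        map_prod (image g) (map (image g)) (map_prod (image h) (map (image h)) p) = p"
    proof
      fix p assume "p \<in> block_systems S i l"
      then obtain B0 Bs where p: "p = (B0, Bs)" "(B0, Bs) \<in> block_systems S i l"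
        by (cases p) auto
      show "map_prod (image g) (map (image g)) (map_prod (image h) (map (image h)) p) = p"
        using image_block_systems_inverse[OF p(2), of g h] gh by (simp add: p(1))
    qed
    show "\<forall>p\<in>block_systems T i l.
        map_prod (image h) (map (image h)) (map_prod (image g) (map (image g)) p) = p"
    proof
      fix p assume "p \<in> block_systems T i l"
      then obtain B0 Bs where p: "p = (B0, Bs)" "(B0, Bs) \<in> block_systems T i l"
        by (cases p) auto
      show "map_prod (image h) (map (image h)) (map_prod (image g) (map (image g)) p) = p"
        using image_block_systems_inverse[OF p(2), of h g] hg by (simp add: p(1))
    qed
    show "map_prod (image h) (map (image h)) ` block_systems S i l \<subseteq> block_systems T i l"
      using image_block_systems[of _ _ S i l h] h by (auto simp: bij_betw_def)
    show "map_prod (image g) (map (image g)) ` block_systems T i l \<subseteq> block_systems S i l"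
      using image_block_systems[of _ _ T i l g] g by (auto simp: bij_betw_def)
  qed
  then show ?thesis by (rule bij_betw_same_card)
qed

lemma card_chains_to:
  assumes "finite F"
  shows "card (chains_to F i l) = restricted_stirling (card F) i l"
proof -
  obtain h where "bij_betw h F {1..card F}"
    using finite_same_card_bij[OF assms, of "{1..card F}"] by auto
  then show ?thesis
    unfolding card_chains_to_eq_block_systems restricted_stirling_eq
    by (rule card_block_systems_cong)
qed

lemma chain_subset_last:
  assumes "sorted_wrt (\<subset>) As" "A \<in> set As"
  shows "A \<subseteq> last As"
proof -
  obtain n where n: "n < length As" "A = As ! n"
    using assms(2) by (metis in_set_conv_nth)
  show ?thesis
  proof (cases "n = length As - 1")
    case True
    with n show ?thesis by (cases As rule: rev_cases) auto
  next
    case False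
    with n have "As ! n \<subset> As ! (length As - 1)"
      by (intro sorted_wrt_nth_less[OF assms(1)]) simp_all
    moreover have "last As = As ! (length As - 1)"
      using n by (intro last_conv_nth) auto
    ultimately show ?thesis using n by simp
  qed
qed

lemma chains_to_subset:
  assumes "(A0, As) \<in> chains_to F i l" "A \<in> set (A0 # As)"
  shows "A \<subseteq> F"
proof -
  have "sorted_wrt (\<subset>) (A0 # As)" "last (A0 # As) = F"
    using assms(1) unfolding chains_to_def by blast+
  then show ?thesis using chain_subset_last[OF _ assms(2)] by metis
qed

lemma finite_chains_to:
  assumes "finite F"
  shows "finite (chains_to F i l)"
proof (rule finite_subset)
  show "chains_to F i l \<subseteq> Pow F \<times> {As. set As \<subseteq> Pow F \<and> length As \<le> i}"
  proof (rule subrelI, intro SigmaI)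
    fix A0 As
    assume chain: "(A0, As) \<in> chains_to F i l"
    note subset = chains_to_subset[OF chain]
    show "A0 \<in> Pow F" using subset[of A0] by simp
    have "length As \<le> i" using chain by (simp add: chains_to_def)
    moreover have "set As \<subseteq> Pow F" using subset by (meson PowI list.set_intros(2) subsetI)
    ultimately show "As \<in> {As. set As \<subseteq> Pow F \<and> length As \<le> i}" by simp
  qed
  show "finite (Pow F \<times> {As. set As \<subseteq> Pow F \<and> length As \<le> i})"
    using assms by (intro finite_cartesian_product finite_lists_length_le) auto
qed

section \<open>Faces of the subdivision as chains\<close>

text \<open>Old vertices and barycenters live in different summands, so a vertex set of the
  subdivision splits into its two parts uniquely.\<close>

lemma partial_sd_vertex_set_eqD:
  assumes "Inl ` A0 \<union> Inr ` set As = Inl ` B0 \<union> Inr ` set Bs"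
  shows "A0 = B0" "set As = set Bs"
proof -
  have preimages: "Inl -` (Inl ` X \<union> Inr ` Y) = X" "Inr -` (Inl ` X \<union> Inr ` Y) = Y"
    for X :: "'x set" and Y :: "'y set"
    by auto
  show "A0 = B0" "set As = set Bs"
    using preimages assms by metis+
qed

lemma card_partial_sd_face:
  assumes "finite A0" "sorted_wrt (\<subset>) As"
  shows "card (Inl ` A0 \<union> Inr ` set As) = card A0 + length As"
proof -
  have "distinct As"
    using assms(2) by (induction As) auto
  then have "card (Inr ` set As :: ('a + 'b set) set) = length As"
    by (simp add: card_image distinct_card)
  moreover have "card (Inl ` A0 :: ('a + 'b set) set) = card A0"
    by (simp add: card_image)
  moreover have "(Inl ` A0 :: ('a + 'b set) set) \<inter> Inr ` set As = {}" by auto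
  ultimately show ?thesis
    using assms(1) by (subst card_Un_disjoint) auto
qed

lemma sd_chain_iff_chains_to:
  assumes "abstract_simplicial_complex \<Delta>"
  shows "sd_chain l \<Delta> A0 As \<and> card A0 + length As = i \<longleftrightarrow>
    (A0, As) \<in> (\<Union>F\<in>\<Delta>. chains_to F i l)"
proof
  assume *: "sd_chain l \<Delta> A0 As \<and> card A0 + length As = i"
  then have "last (A0 # As) \<in> \<Delta>"
    using last_in_set[of "A0 # As"] unfolding sd_chain_def by blast
  with * show "(A0, As) \<in> (\<Union>F\<in>\<Delta>. chains_to F i l)"
    by (auto simp: sd_chain_def chains_to_def)
next
  assume "(A0, As) \<in> (\<Union>F\<in>\<Delta>. chains_to F i l)"
  then obtain F where F: "F \<in> \<Delta>" "(A0, As) \<in> chains_to F i l" by blast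
  have "A \<in> \<Delta>" if "A \<in> set (A0 # As)" for A
  proof -
    have "A \<subseteq> F" using F(2) that by (rule chains_to_subset)
    then show ?thesis using assms F(1) by (auto simp: abstract_simplicial_complex_def)
  qed
  then show "sd_chain l \<Delta> A0 As \<and> card A0 + length As = i"
    using F(2) by (auto simp: sd_chain_def chains_to_def)
qed

lemma f_number_partial_sd:
  assumes \<Delta>: "abstract_simplicial_complex \<Delta>"
  shows "f_number (partial_sd l \<Delta>) (int i - 1) = card (\<Union>F\<in>\<Delta>. chains_to F i l)"
proof -
  let ?C = "{(A0, As). sd_chain l \<Delta> A0 As \<and> card A0 + length As = i}"
  let ?face = "\<lambda>(A0, As). Inl ` A0 \<union> Inr ` set As"
  have fin: "finite A0" "\<forall>A\<in>set As. finite A" "sorted_wrt (\<subset>) As"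
    if "sd_chain l \<Delta> A0 As" for A0 As
    using that \<Delta> by (auto simp: sd_chain_def abstract_simplicial_complex_def)
  have "inj_on ?face ?C"
  proof (rule inj_onI, clarify)
    fix A0 As B0 Bs
    assume sd: "sd_chain l \<Delta> A0 As" "sd_chain l \<Delta> B0 Bs"
      and "Inl ` A0 \<union> Inr ` set As = Inl ` B0 \<union> Inr ` set Bs"
    note eq = partial_sd_vertex_set_eqD[OF this(3)]
    show "A0 = B0 \<and> As = Bs"
      using eq fin[OF sd(1)] fin[OF sd(2)] by (auto intro: strict_chain_eqI)
  qed
  moreover have "{G \<in> partial_sd l \<Delta>. face_dim G = int i - 1} = ?face ` ?C"
  proof (rule set_eqI)
    fix G
    have "G \<in> {G \<in> partial_sd l \<Delta>. face_dim G = int i - 1} \<longleftrightarrow>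
      (\<exists>A0 As. G = Inl ` A0 \<union> Inr ` set As \<and> sd_chain l \<Delta> A0 As \<and> card G = i)"
      by (auto simp: partial_sd_def face_dim_def)
    also have "\<dots> \<longleftrightarrow> (\<exists>A0 As. G = Inl ` A0 \<union> Inr ` set As \<and> sd_chain l \<Delta> A0 As \<and>
      card A0 + length As = i)"
      using card_partial_sd_face fin by metis
    also have "\<dots> \<longleftrightarrow> G \<in> ?face ` ?C" by auto
    finally show "G \<in> {G \<in> partial_sd l \<Delta>. face_dim G = int i - 1} \<longleftrightarrow> G \<in> ?face ` ?C" .
  qed
  ultimately have "f_number (partial_sd l \<Delta>) (int i - 1) = card ?C"
    unfolding f_number_def by (simp add: card_image)
  also have "?C = (\<Union>F\<in>\<Delta>. chains_to F i l)"
    using sd_chain_iff_chains_to[OF \<Delta>] by blast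
  finally show ?thesis .
qed

lemma card_le_of_complex_dim:
  assumes "finite \<Delta>" "complex_dim \<Delta> = int d - 1" "F \<in> \<Delta>"
  shows "card F \<le> d"
proof -
  have "face_dim F \<le> complex_dim \<Delta>"
    unfolding complex_dim_def using assms by (intro Max_ge) auto
  then show ?thesis using assms(2) by (simp add: face_dim_def)
qed

section \<open>The \<open>f\<close>-vector of the partial subdivision\<close>

theorem lemma3p1:
  fixes \<Delta> :: "'a set set" and d l i :: nat
  assumes "abstract_simplicial_complex \<Delta>" and "finite \<Delta>"
    and "complex_dim \<Delta> = int d - 1"
    and "1 \<le> l" and "l \<le> d" and "i \<le> d"
  shows "f_number (partial_sd l \<Delta>) (int i - 1) =
    (\<Sum>j=0..d. f_number \<Delta> (int j - 1) * restricted_stirling j i l)"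
proof -
  have fin: "finite F" if "F \<in> \<Delta>" for F
    using assms(1) that by (simp add: abstract_simplicial_complex_def)
  have f_number_eq: "f_number \<Delta> (int j - 1) = card {F \<in> \<Delta>. card F = j}" for j
    by (simp add: f_number_def face_dim_def)
  have "f_number (partial_sd l \<Delta>) (int i - 1) = card (\<Union>F\<in>\<Delta>. chains_to F i l)"
    using assms(1) by (rule f_number_partial_sd)
  also have "\<dots> = (\<Sum>F\<in>\<Delta>. card (chains_to F i l))"
    using assms(2) fin
    \<comment> \<open>Chains with different tops are different, hence the union is disjoint.\<close>
    by (intro card_UN_disjoint) (simp_all add: finite_chains_to, auto simp: chains_to_def)
  also have "\<dots> = (\<Sum>F\<in>\<Delta>. restricted_stirling (card F) i l)"
    using fin by (simp add: card_chains_to)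
  also have "\<dots> = (\<Sum>j=0..d. \<Sum>F\<in>{F \<in> \<Delta>. card F = j}. restricted_stirling (card F) i l)"
    using assms(2) card_le_of_complex_dim[OF assms(2,3)]
    by (intro sum.group[symmetric]) auto
  also have "\<dots> = (\<Sum>j=0..d. f_number \<Delta> (int j - 1) * restricted_stirling j i l)"
    by (simp add: f_number_eq)
  finally show ?thesis .
qed

end
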